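(* Consider the adjacency-list model augmented with $\texttt{IN-SORTED}$ and $\texttt{ADJ}$ (and without $\texttt{JUMP}$). For any $n$ and $m$ with $n\le m\le n^2$, there exists a directed graph $G=(V,E)$ with $\Theta(n)$ nodes and $\Theta(m)$ edges such that for any algorithm solving the single-node problem, the expected running time on $G$, averaged over all targets $t\in V$, is $\Omega(n)$. In particular, this bound holds for a worst-case target $t\in V$.
   Context: Fix a constant $\alpha\in(0,1)$. For a directed graph $G=(V,E)$ with $n=|V|$, an $\alpha$-discounted random walk from $s$: at each step, with probability $\alpha$ it terminates at the current node, otherwise it moves to a uniformly random out-neighbor of the current node. $\pi(s,t)$ is the probability that such a walk from $s$ terminates at $t$, and $\pi(t)=\frac1n\sum_{s\in V}\pi(s,t)$. Adjacency-list model: an algorithm accesses $G$ only through constant-time queries $\texttt{DEG-IN}(u)$, $\texttt{DEG-OUT}(u)$ (in-/out-degree of $u$), $\texttt{IN}(u,i)$, $\texttt{OUT}(u,i)$ ($i$-th in-/out-neighbor of $u$). Additional queries: $\texttt{ADJ}(u,v)$ returns whether $(u,v)\in E$; $\texttt{IN-SORTED}(u,i)$ returns the $i$-th in-neighbor of $u$ when in-neighbors are sorted by out-degree. Single-node problem: given $G$ (via queries) and a target $t\in V$, output $\hat\pi(t)$ with $\Pr\{|\hat\pi(t)-\pi(t)|\ge\varepsilon\pi(t)\}\le p_f$, where $\varepsilon,p_f$ are fixed small constants; an algorithm solves the problem if this holds for every input. *)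

theory Defs
  imports "HOL-Probability.Probability" "Graph_Theory.Pair_Digraph"
begin

text \<open>
  Loops are allowed, parallel arcs are not. Every node has an out-neighbour, so that each step of
  the discounted walk is well-defined; no convention for sinks is needed.
\<close>

definition input_graph :: "nat pair_pre_digraph \<Rightarrow> bool" where
  "input_graph G \<longleftrightarrow>
     pair_fin_digraph G \<and> (\<forall>u\<in>pverts G. \<exists>v. (u, v) \<in> parcs G)"

text \<open>The terminal node of the walk that starts at \<open>u\<close>.\<close>

partial_function (spmf) discounted_walk ::
  "real \<Rightarrow> nat pair_pre_digraph \<Rightarrow> nat \<Rightarrow> nat spmf" where
  "discounted_walk \<alpha> G u =
     bind_spmf (spmf_of_pmf (bernoulli_pmf \<alpha>)) (\<lambda>stop.
       if stop then return_spmf u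
       else bind_spmf (spmf_of_pmf (pmf_of_set {v. (u, v) \<in> parcs G}))
              (\<lambda>v. discounted_walk \<alpha> G v))"

definition ppr :: "real \<Rightarrow> nat pair_pre_digraph \<Rightarrow> nat \<Rightarrow> nat \<Rightarrow> real" where
  "ppr \<alpha> G s t = spmf (discounted_walk \<alpha> G s) t"

definition pagerank :: "real \<Rightarrow> nat pair_pre_digraph \<Rightarrow> nat \<Rightarrow> real" where
  "pagerank \<alpha> G t = (\<Sum>s\<in>pverts G. ppr \<alpha> G s t) / real (card (pverts G))"

text \<open>
  The lists behind \<open>IN\<close> and \<open>OUT\<close> may be in any order; \<open>IN-SORTED\<close> may break ties arbitrarily.
\<close>

record adj_lists =
  in_list :: "nat \<Rightarrow> nat list"
  out_list :: "nat \<Rightarrow> nat list"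
  in_sorted_list :: "nat \<Rightarrow> nat list"

definition represents :: "adj_lists \<Rightarrow> nat pair_pre_digraph \<Rightarrow> bool" where
  "represents L G \<longleftrightarrow> (\<forall>u\<in>pverts G.
     distinct (in_list L u) \<and> set (in_list L u) = {v. (v, u) \<in> parcs G} \<and>
     distinct (out_list L u) \<and> set (out_list L u) = {v. (u, v) \<in> parcs G} \<and>
     distinct (in_sorted_list L u) \<and> set (in_sorted_list L u) = {v. (v, u) \<in> parcs G} \<and>
     sorted (map (out_degree (with_proj G)) (in_sorted_list L u)))"

datatype query =
    Deg_In nat
  | Deg_Out nat
  | In nat nat
  | Out nat nat
  | In_Sorted nat nat
  | Adj nat nat

datatype answer =
    Number nat
  | Node "nat option"
  | Truth bool
  | Refused

type_synonym transcript = "(query \<times> answer) list"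

definition ith :: "'a list \<Rightarrow> nat \<Rightarrow> 'a option" where
  "ith xs i = (if 1 \<le> i \<and> i \<le> length xs then Some (xs ! (i - 1)) else None)"

fun query_nodes :: "query \<Rightarrow> nat set" where
  "query_nodes (Deg_In u) = {u}"
| "query_nodes (Deg_Out u) = {u}"
| "query_nodes (In u i) = {u}"
| "query_nodes (Out u i) = {u}"
| "query_nodes (In_Sorted u i) = {u}"
| "query_nodes (Adj u v) = {u, v}"

definition known_nodes :: "nat \<Rightarrow> transcript \<Rightarrow> nat set" where
  "known_nodes t h = insert t {v. Node (Some v) \<in> snd ` set h}"

fun graph_answer :: "nat pair_pre_digraph \<Rightarrow> adj_lists \<Rightarrow> query \<Rightarrow> answer" where
  "graph_answer G L (Deg_In u) = Number (in_degree (with_proj G) u)"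
| "graph_answer G L (Deg_Out u) = Number (out_degree (with_proj G) u)"
| "graph_answer G L (In u i) = Node (ith (in_list L u) i)"
| "graph_answer G L (Out u i) = Node (ith (out_list L u) i)"
| "graph_answer G L (In_Sorted u i) = Node (ith (in_sorted_list L u) i)"
| "graph_answer G L (Adj u v) = Truth ((u, v) \<in> parcs G)"

text \<open>
  There is no \<open>JUMP\<close>: only the target and nodes returned by earlier queries can be queried.
  Guessing the identifier of any other node yields no information.
\<close>

definition respond ::
  "nat pair_pre_digraph \<Rightarrow> adj_lists \<Rightarrow> nat \<Rightarrow> transcript \<Rightarrow> query \<Rightarrow> answer" where
  "respond G L t h q =
     (if query_nodes q \<subseteq> known_nodes t h then graph_answer G L q else Refused)"

text \<open>
  An algorithm is told the number of nodes, the number of edges and the target; the random choice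
  of its next action may depend on these and on everything it has seen so far. Remembering earlier
  internal coin flips would add no power: they can be resampled conditioned on the transcript.
\<close>

datatype action = Query query | Output real

type_synonym algorithm = "nat \<Rightarrow> nat \<Rightarrow> nat \<Rightarrow> transcript \<Rightarrow> action pmf"

partial_function (spmf) run ::
  "(transcript \<Rightarrow> action pmf) \<Rightarrow> (transcript \<Rightarrow> query \<Rightarrow> answer) \<Rightarrow> transcript \<Rightarrow>
   (real \<times> transcript) spmf" where
  "run next_action orc h =
     bind_spmf (spmf_of_pmf (next_action h)) (\<lambda>a.
       case a of
         Output x \<Rightarrow> return_spmf (x, h)
       | Query q \<Rightarrow> run next_action orc (h @ [(q, orc h q)]))"

definition execution ::
  "algorithm \<Rightarrow> nat pair_pre_digraph \<Rightarrow> adj_lists \<Rightarrow> nat \<Rightarrow> (real \<times> transcript) spmf" where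
  "execution A G L t =
     run (A (card (pverts G)) (card (parcs G)) t) (respond G L t) []"

text \<open>
  The value \<open>None\<close> of an execution stands for non-termination. It counts as a failure, and as
  infinite running time. Only queries are charged, at unit cost; charging internal computation as
  well could only increase the running time.
\<close>

definition failure :: "real \<Rightarrow> real \<Rightarrow> (real \<times> transcript) option set" where
  "failure \<epsilon> p = {r. case r of None \<Rightarrow> True | Some (x, h) \<Rightarrow> \<bar>x - p\<bar> \<ge> \<epsilon> * p}"

definition solves_single_node :: "real \<Rightarrow> real \<Rightarrow> real \<Rightarrow> algorithm \<Rightarrow> bool" where
  "solves_single_node \<alpha> \<epsilon> p\<^sub>f A \<longleftrightarrow>
     (\<forall>G L. input_graph G \<longrightarrow> represents L G \<longrightarrow>
       (\<forall>t\<in>pverts G.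
         measure_pmf.prob (execution A G L t) (failure \<epsilon> (pagerank \<alpha> G t)) \<le> p\<^sub>f))"

definition expected_time ::
  "algorithm \<Rightarrow> nat pair_pre_digraph \<Rightarrow> adj_lists \<Rightarrow> nat \<Rightarrow> ennreal" where
  "expected_time A G L t =
     (\<integral>\<^sup>+ r. (case r of None \<Rightarrow> \<infinity> | Some (x, h) \<Rightarrow> of_nat (length h))
        \<partial>measure_pmf (execution A G L t))"

definition average_expected_time ::
  "algorithm \<Rightarrow> nat pair_pre_digraph \<Rightarrow> adj_lists \<Rightarrow> ennreal" where
  "average_expected_time A G L =
     (\<Sum>t\<in>pverts G. expected_time A G L t) / of_nat (card (pverts G))"

end

theory Submission
  imports Defs
begin

text \<open>
  Every target in \<open>T\<close> is fed by a hub \<open>w\<close> that points to all of \<open>T\<close> and has the in-neighbours \<open>S\<close>;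
  here \<open>T\<close> and \<open>S\<close> have \<open>n\<close> elements. A set \<open>Z\<close> of \<open>K n\<close> nodes with loops and a component \<open>D\<close> with
  \<open>m\<close> arcs are unreachable from the targets. Redirecting the loops of \<open>Z\<close> to a single \<open>s \<in> S\<close> changes
  neither the number of nodes nor the number of arcs nor any out-degree, but pushes enough mass
  through \<open>w\<close> to multiply the PageRank of every target by a constant as large as desired. Until it
  queries \<open>s\<close>, an algorithm cannot tell the two graphs apart. As both graphs must be answered
  correctly, on the original graph each \<open>s \<in> S\<close> is queried with probability at least \<open>1 - 2 p\<^sub>f\<close>, and
  a query involves at most two nodes, so the expected number of queries is at least
  \<open>n (1 - 2 p\<^sub>f) / 2\<close>.
\<close>

section \<open>The recurrence for the walk probabilities\<close>

lemma input_graphD: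
  assumes "input_graph G"
  shows "finite (pverts G)" "finite (parcs G)" "parcs G \<subseteq> pverts G \<times> pverts G"
    "u \<in> pverts G \<Longrightarrow> {v. (u, v) \<in> parcs G} \<noteq> {}"
  using assms
  by (auto simp: input_graph_def pair_fin_digraph_def pair_wf_digraph_def pair_fin_digraph_axioms_def)

text \<open>Condition on the first step. Every node has an out-neighbour and only finitely many, so
  the uniform choice is a genuine average over them.\<close>

lemma ppr_unfold:
  assumes "0 \<le> \<alpha>" "\<alpha> \<le> 1" and G: "input_graph G" "u \<in> pverts G"
  shows "ppr \<alpha> G u t = \<alpha> * of_bool (u = t) +
    (1 - \<alpha>) * ((\<Sum>v | (u, v) \<in> parcs G. ppr \<alpha> G v t) / card {v. (u, v) \<in> parcs G})"
proof -
  have "{v. (u, v) \<in> parcs G} \<subseteq> pverts G" using input_graphD[OF G(1)] by auto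
  then have "finite {v. (u, v) \<in> parcs G}" using input_graphD[OF G(1)] finite_subset by metis
  moreover have "{v. (u, v) \<in> parcs G} \<noteq> {}" using input_graphD[OF G(1)] G by metis
  ultimately show ?thesis using assms(1,2)
    unfolding ppr_def
    by (subst discounted_walk.simps)
      (simp add: spmf_bind integral_spmf_of_set mult.commute indicator_def del: bind_spmf_of_pmf)
qed

text \<open>A walk never leaves a closed set. This removes \<open>D\<close> and \<open>Z\<close>
  from the PageRank of a target in the original graph.\<close>

lemma ppr_eq_0_if_closed:
  assumes "0 < \<alpha>" "\<alpha> \<le> 1" and G: "input_graph G" and "S \<subseteq> pverts G"
    and closed: "\<And>u v. u \<in> S \<Longrightarrow> (u, v) \<in> parcs G \<Longrightarrow> v \<in> S"
    and "t \<notin> S" "s \<in> S"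
  shows "ppr \<alpha> G s t = 0"
proof -
  have fS: "finite S" using \<open>S \<subseteq> pverts G\<close> input_graphD[OF G] finite_subset by metis
  \<comment> \<open>Maximum principle: a maximal value \<open>M\<close> on \<open>S\<close> satisfies \<open>M \<le> (1 - \<alpha>) M\<close>.\<close>
  define M where "M = Max ((\<lambda>v. ppr \<alpha> G v t) ` S)"
  have le: "ppr \<alpha> G v t \<le> M" if "v \<in> S" for v unfolding M_def using fS that by simp
  have "M \<in> (\<lambda>v. ppr \<alpha> G v t) ` S" unfolding M_def using fS \<open>s \<in> S\<close> by (intro Max_in) auto
  then obtain u where u: "u \<in> S" "M = ppr \<alpha> G u t" by auto
  let ?N = "{v. (u, v) \<in> parcs G}"
  have "?N \<subseteq> S" using closed u by auto
  then have "finite ?N" using fS finite_subset by auto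
  have "?N \<noteq> {}" using input_graphD[OF G] u \<open>S \<subseteq> pverts G\<close> by blast
  have "(\<Sum>v\<in>?N. ppr \<alpha> G v t) \<le> card ?N * M"
    using le \<open>?N \<subseteq> S\<close> by (intro sum_bounded_above) auto
  then have "(\<Sum>v\<in>?N. ppr \<alpha> G v t) / card ?N \<le> M"
    using \<open>finite ?N\<close> \<open>?N \<noteq> {}\<close> by (simp add: divide_simps card_gt_0_iff mult.commute)
  then have "M \<le> (1 - \<alpha>) * M"
    using ppr_unfold[of \<alpha> G u t] assms u mult_left_mono[of _ M "1 - \<alpha>"] by fastforce
  then have "M \<le> 0" using \<open>0 < \<alpha>\<close> by (simp add: algebra_simps mult_le_0_iff)
  then show ?thesis using le[OF \<open>s \<in> S\<close>] pmf_nonneg unfolding ppr_def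
    by (metis order_antisym order_trans)
qed

section \<open>Queried nodes, and runs against two oracles\<close>

text \<open>Refused queries count too: their nodes are still at most two per query.\<close>

definition touched :: "transcript \<Rightarrow> nat set" where
  "touched h = (\<Union>(q, a)\<in>set h. query_nodes q)"

lemma card_query_nodes_le: "card (query_nodes q) \<le> 2"
  by (cases q) (auto intro: order_trans[OF card_insert_le_m1])

lemma finite_query_nodes: "finite (query_nodes q)"
  by (cases q) auto

lemma card_touched_le: "finite (touched h) \<and> card (touched h) \<le> 2 * length h"
proof (induction h)
  case Nil
  then show ?case by (simp add: touched_def)
next
  case (Cons p h)
  have "touched (p # h) = query_nodes (fst p) \<union> touched h" by (auto simp: touched_def)
  then show ?case using Cons card_Un_le[of "query_nodes (fst p)" "touched h"]
      card_query_nodes_le[of "fst p"] finite_query_nodes[of "fst p"] by auto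
qed

text \<open>Suprema of chains of subdistributions are pointwise, so upper bounds survive the limit
  in the fixed-point induction on \<open>run\<close>.\<close>

lemma admissible_spmf_le:
  "ccpo.admissible lub_spmf (ord_spmf (=)) (\<lambda>p. spmf p x \<le> c)"
proof (rule ccpo.admissibleI)
  fix Y assume Y: "Complete_Partial_Order.chain (ord_spmf (=)) Y" "Y \<noteq> {}" "\<forall>p\<in>Y. spmf p x \<le> c"
  then show "spmf (lub_spmf Y) x \<le> c" by (auto simp: spmf_lub_spmf intro!: cSUP_least)
qed

text \<open>
  The invariant \<open>I\<close> is needed because the two oracles agree only on transcripts that can arise from \<open>orc\<close>.
\<close>

lemma run_until_touched:
  assumes agree: "\<And>h q. I h \<Longrightarrow> x \<notin> query_nodes q \<Longrightarrow> orc h q = orc' h q"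
    and inv: "\<And>h q. I h \<Longrightarrow> I (h @ [(q, orc h q)])"
    and "I h\<^sub>0" "x \<notin> touched h"
  shows "spmf (run act orc h\<^sub>0) (y, h) \<le> spmf (run act orc' h\<^sub>0) (y, h)"
proof -
  \<comment> \<open>The right-hand run is held fixed while the induction builds up the left one: the
    claim is then an upper bound on the approximants, which is admissible.\<close>
  define r where "r = run act orc'"
  \<comment> \<open>The first conjunct says that transcripts only grow; it is carried along for the
    case where \<open>x\<close> is queried.\<close>
  have "\<forall>h\<^sub>0. set_spmf (run act orc h\<^sub>0) \<subseteq> {(y, h). \<exists>k. h = h\<^sub>0 @ k} \<and>
     (\<forall>y h. I h\<^sub>0 \<longrightarrow> x \<notin> touched h \<longrightarrow>
        spmf (run act orc h\<^sub>0) (y, h) \<le> spmf (r h\<^sub>0) (y, h))"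
  proof (induction rule: run.fixp_induct)
    case 1
    have sub: "mcont (fun_lub lub_spmf) (fun_ord (ord_spmf (=))) lub_spmf (ord_spmf (=))
       (\<lambda>f. f ((act, orc), h))" for h :: transcript
      by simp
    show ?case unfolding curry_def
      by (intro admissible_all admissible_conj admissible_imp
          admissible_subst[OF admissible_spmf_le sub]) simp_all
  next
    case 2
    show ?case by simp
  next
    case (3 f)
    show ?case
    proof (intro allI conjI impI)
      fix h\<^sub>0
      show "set_spmf (spmf_of_pmf (act h\<^sub>0) \<bind> (\<lambda>a. case a of
          Query q \<Rightarrow> f act orc (h\<^sub>0 @ [(q, orc h\<^sub>0 q)]) | Output x \<Rightarrow> return_spmf (x, h\<^sub>0)))
        \<subseteq> {(y, h). \<exists>k. h = h\<^sub>0 @ k}"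
      proof -
        have "set_spmf (f act orc (h\<^sub>0 @ [(q, orc h\<^sub>0 q)])) \<subseteq> {(y, h). \<exists>k. h = h\<^sub>0 @ k}" for q
          using 3[rule_format, of "h\<^sub>0 @ [(q, orc h\<^sub>0 q)]"] by fastforce
        then show ?thesis
          by (simp add: set_bind_spmf UN_subset_iff bind_UNION split: action.split del: bind_spmf_of_pmf)
      qed
    next
      fix h\<^sub>0 y h assume h: "I h\<^sub>0" "x \<notin> touched h"
      have "spmf (f act orc (h\<^sub>0 @ [(q, orc h\<^sub>0 q)])) (y, h) \<le>
          spmf (r (h\<^sub>0 @ [(q, orc' h\<^sub>0 q)])) (y, h)" for q
      proof (cases "x \<in> query_nodes q")
        case True
        \<comment> \<open>Once \<open>x\<close> is queried, every final transcript touches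
          \<open>x\<close>, so \<open>h\<close> cannot be reached.\<close>
        have "(y, h) \<notin> set_spmf (f act orc (h\<^sub>0 @ [(q, orc h\<^sub>0 q)]))"
        proof
          assume "(y, h) \<in> set_spmf (f act orc (h\<^sub>0 @ [(q, orc h\<^sub>0 q)]))"
          then obtain k where "h = h\<^sub>0 @ [(q, orc h\<^sub>0 q)] @ k"
            using 3[rule_format, of "h\<^sub>0 @ [(q, orc h\<^sub>0 q)]"] by auto
          then show False using True h by (auto simp: touched_def)
        qed
        then have "spmf (f act orc (h\<^sub>0 @ [(q, orc h\<^sub>0 q)])) (y, h) = 0"
          by (simp add: in_set_spmf_iff_spmf)
        then show ?thesis by simp
      next
        case False
        then show ?thesis using 3 h inv[of h\<^sub>0 q] agree[of h\<^sub>0 q] by metis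
      qed
      then show "spmf (spmf_of_pmf (act h\<^sub>0) \<bind> (\<lambda>a. case a of
          Query q \<Rightarrow> f act orc (h\<^sub>0 @ [(q, orc h\<^sub>0 q)]) | Output x \<Rightarrow> return_spmf (x, h\<^sub>0))) (y, h)
        \<le> spmf (r h\<^sub>0) (y, h)"
        unfolding r_def
        by (subst run.simps) (auto simp: spmf_bind simp del: bind_spmf_of_pmf split: action.split
            intro!: integral_mono measure_pmf.integrable_const_bound[where B=1] pmf_le_1)
    qed
  qed
  then show ?thesis using assms unfolding r_def by blast
qed


section \<open>From correctness on two inputs to a bound on the number of queries\<close>

lemma measure_pmf_mono_on:
  assumes "\<And>x. x \<in> B \<Longrightarrow> pmf M x \<le> pmf M' x"
  shows "measure_pmf.prob M B \<le> measure_pmf.prob M' B"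
proof -
  have "emeasure (measure_pmf M) B = (\<integral>\<^sup>+ x. ennreal (pmf M x) * indicator B x \<partial>count_space UNIV)"
    by (simp flip: nn_integral_measure_pmf)
  also have "\<dots> \<le> (\<integral>\<^sup>+ x. ennreal (pmf M' x) * indicator B x \<partial>count_space UNIV)"
    using assms by (intro nn_integral_mono) (auto simp: indicator_def)
  also have "\<dots> = emeasure (measure_pmf M') B"
    by (simp flip: nn_integral_measure_pmf)
  finally show ?thesis by (simp add: measure_pmf.emeasure_eq_measure)
qed

text \<open>Non-terminating runs are left out, as they already belong to
  \<open>failure\<close>.\<close>

definition touching :: "nat \<Rightarrow> (real \<times> transcript) option set" where
  "touching x = {Some (y, h) | y h. x \<in> touched h}"

text \<open>A run that neither fails for \<open>p\<close> nor touches \<open>x\<close> gives a wrong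
  answer for \<open>p'\<close> and is at least as likely under \<open>M'\<close>. Such runs thus
  have probability at most \<open>p\<^sub>f\<close>, and a union bound leaves the remaining mass to
  \<open>touching x\<close>.\<close>

lemma prob_touching_ge:
  assumes fail: "measure_pmf.prob M (failure \<epsilon> p) \<le> p\<^sub>f"
    and fail': "measure_pmf.prob M' (failure \<epsilon> p') \<le> p\<^sub>f"
    and gap: "(1 + \<epsilon>) * p \<le> (1 - \<epsilon>) * p'"
    and le: "\<And>y h. x \<notin> touched h \<Longrightarrow> spmf M (y, h) \<le> spmf M' (y, h)"
  shows "1 - 2 * p\<^sub>f \<le> measure_pmf.prob M (touching x)"
proof -
  define B where "B = - (failure \<epsilon> p \<union> touching x)"
  have "failure \<epsilon> p \<union> touching x \<union> B = UNIV" by (auto simp: B_def)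
  then have "1 = measure_pmf.prob M (failure \<epsilon> p \<union> touching x \<union> B)" by simp
  also have "\<dots> \<le> measure_pmf.prob M (failure \<epsilon> p) + measure_pmf.prob M (touching x) +
      measure_pmf.prob M B"
    using measure_Un_le[of "failure \<epsilon> p \<union> touching x" "measure_pmf M" B]
      measure_Un_le[of "failure \<epsilon> p" "measure_pmf M" "touching x"] by simp
  also have "measure_pmf.prob M B \<le> measure_pmf.prob M' B"
  proof (rule measure_pmf_mono_on)
    fix r assume "r \<in> B"
    then show "pmf M r \<le> pmf M' r" using le
      by (cases r) (auto simp: B_def failure_def touching_def)
  qed
  also have "\<dots> \<le> measure_pmf.prob M' (failure \<epsilon> p')"
  proof (rule measure_pmf.finite_measure_mono)
    show "B \<subseteq> failure \<epsilon> p'"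
    proof
      fix r assume r: "r \<in> B"
      show "r \<in> failure \<epsilon> p'"
      proof (cases r)
        case None
        then show ?thesis by (simp add: failure_def)
      next
        case (Some yh)
        obtain y h where "yh = (y, h)" by force
        then have "\<bar>y - p\<bar> < \<epsilon> * p" using r Some by (simp add: B_def failure_def)
        \<comment> \<open>The accepted ranges do not meet:
          \<open>y < (1 + \<epsilon>) * p \<le> (1 - \<epsilon>) * p'\<close>.\<close>
        then have "\<bar>y - p'\<bar> \<ge> \<epsilon> * p'" using gap by (simp add: algebra_simps)
        then show ?thesis using Some \<open>yh = (y, h)\<close> by (simp add: failure_def)
      qed
    qed
  qed simp
  finally show ?thesis using fail fail' by simp
qed

text \<open>By linearity, the probabilities sum to the expected number of touched elements of
  \<open>S\<close>, which is at most twice the expected length.\<close>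

lemma expected_length_ge:
  fixes M :: "(real \<times> transcript) spmf"
  assumes "finite S" "0 \<le> c" and touch: "\<And>x. x \<in> S \<Longrightarrow> c \<le> measure_pmf.prob M (touching x)"
  shows "ennreal (real (card S) * c / 2) \<le>
    (\<integral>\<^sup>+ r. (case r of None \<Rightarrow> \<infinity> | Some (y, h) \<Rightarrow> of_nat (length h)) \<partial>measure_pmf M)" (is "_ \<le> ?E")
proof -
  let ?len = "\<lambda>r :: (real \<times> transcript) option. case r of None \<Rightarrow> \<infinity> :: ennreal | Some (y, h) \<Rightarrow> of_nat (length h)"
  have "ennreal (real (card S) * c) = (\<Sum>x\<in>S. ennreal c)"
    using \<open>0 \<le> c\<close> by (simp add: ennreal_mult ennreal_of_nat_eq_real_of_nat)
  also have "\<dots> \<le> (\<Sum>x\<in>S. emeasure (measure_pmf M) (touching x))"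
    using touch by (intro sum_mono) (simp add: measure_pmf.emeasure_eq_measure)
  also have "\<dots> = (\<integral>\<^sup>+ r. (\<Sum>x\<in>S. indicator (touching x) r) \<partial>measure_pmf M)"
    by (simp add: nn_integral_sum)
  also have "\<dots> \<le> (\<integral>\<^sup>+ r. 2 * ?len r \<partial>measure_pmf M)"
  proof (rule nn_integral_mono)
    fix r
    show "(\<Sum>x\<in>S. indicator (touching x) r) \<le> 2 * ?len r"
    proof (cases r)
      case None
      then show ?thesis by (simp add: ennreal_mult_top)
    next
      case (Some yh)
      obtain y h where yh: "yh = (y, h)" by force
      have "(\<Sum>x\<in>S. indicator (touching x) r) = (of_nat (card (S \<inter> touched h)) :: ennreal)"
        using \<open>finite S\<close> Some yh by (simp add: touching_def indicator_def sum.If_cases Int_def)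
      also have "card (S \<inter> touched h) \<le> 2 * length h"
        using card_touched_le[of h] card_mono[of "touched h" "S \<inter> touched h"] by auto
      finally show ?thesis using Some yh by simp
    qed
  qed
  also have "\<dots> = 2 * ?E" by (simp add: nn_integral_cmult)
  finally have *: "ennreal (real (card S) * c) \<le> 2 * ?E" .
  have "ennreal (real (card S) * c / 2) = ennreal (real (card S) * c) / 2"
    using \<open>0 \<le> c\<close> by (simp flip: divide_ennreal)
  also have "\<dots> \<le> 2 * ?E / 2" using * by (rule divide_right_mono_ennreal)
  also have "\<dots> = ?E"
    by (metis mult.commute ennreal_mult_divide_eq ennreal_numeral ennreal_neq_top numeral_neq_zero zero_neq_numeral)
  finally show ?thesis .
qed

section \<open>The family of hard instances\<close>

lemma card_Id_on: "card (Id_on A) = card A"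
  unfolding Id_on_def by (simp add: UNION_singleton_eq_range card_image inj_on_def)


text \<open>The loops in \<open>E\<close> give every node of \<open>D\<close> an out-neighbour
  whatever the other arcs are; \<open>T \<noteq> {}\<close> does the same for \<open>w\<close>. The
  freedom in \<open>E\<close> adjusts the number of arcs.\<close>

locale hidden_source =
  fixes T S D Z :: "nat set" and w :: nat and E :: "(nat \<times> nat) set"
  assumes finite: "finite T" "finite S" "finite D" "finite Z"
    and disjoint: "T \<inter> S = {}" "T \<inter> D = {}" "T \<inter> Z = {}" "S \<inter> D = {}" "S \<inter> Z = {}" "D \<inter> Z = {}"
    and w: "w \<notin> T" "w \<notin> S" "w \<notin> D" "w \<notin> Z"
    and T_nonempty: "T \<noteq> {}"
    and E: "Id_on D \<subseteq> E" "E \<subseteq> D \<times> D"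
begin

text \<open>The two instances differ only in the arcs \<open>F\<close> that leave \<open>Z\<close>,
  so common facts are proved once for all \<open>F\<close>. The loops on \<open>T\<close> make each
  target absorbing.\<close>

definition graph :: "(nat \<times> nat) set \<Rightarrow> nat pair_pre_digraph" where
  "graph F = \<lparr>pverts = insert w (T \<union> S \<union> D \<union> Z),
     parcs = Id_on T \<union> {w} \<times> T \<union> S \<times> {w} \<union> E \<union> F\<rparr>"

abbreviation "base \<equiv> graph (Id_on Z)"
abbreviation "planted s \<equiv> graph (Z \<times> {s})"

lemma pverts_graph [simp]: "pverts (graph F) = insert w (T \<union> S \<union> D \<union> Z)"
  by (simp add: graph_def)

lemma parcs_graph: "parcs (graph F) = Id_on T \<union> {w} \<times> T \<union> S \<times> {w} \<union> E \<union> F"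
  by (simp add: graph_def)

lemma finite_E: "finite E"
  using E(2) finite by (auto intro: finite_subset)

lemma input_graph_base: "input_graph base"
  using finite finite_E E T_nonempty
  by (auto simp: input_graph_def pair_fin_digraph_def pair_wf_digraph_def pair_fin_digraph_axioms_def
      parcs_graph Id_on_def)

lemma input_graph_planted: "s \<in> S \<Longrightarrow> input_graph (planted s)"
  using finite finite_E E T_nonempty
  by (auto simp: input_graph_def pair_fin_digraph_def pair_wf_digraph_def pair_fin_digraph_axioms_def
      parcs_graph Id_on_def)

text \<open>The five families of arcs have pairwise disjoint sets of sources.\<close>

lemma card_parcs_graph:
  assumes "finite F" "F \<subseteq> Z \<times> UNIV"
  shows "card (parcs (graph F)) = 2 * card T + card S + card E + card F"
proof -
  have "card (Id_on T \<union> {w} \<times> T \<union> S \<times> {w} \<union> E \<union> F) =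
      card (Id_on T) + card ({w} \<times> T) + card (S \<times> {w}) + card E + card F"
  proof -
    have "finite (Id_on T)" using finite by (auto intro: finite_subset[of _ "T \<times> T"])
    moreover have "Id_on T \<inter> {w} \<times> T = {}" "(Id_on T \<union> {w} \<times> T) \<inter> S \<times> {w} = {}"
      "(Id_on T \<union> {w} \<times> T \<union> S \<times> {w}) \<inter> E = {}" "(Id_on T \<union> {w} \<times> T \<union> S \<times> {w} \<union> E) \<inter> F = {}"
      using assms disjoint w E by auto
    ultimately show ?thesis using finite finite_E assms by (simp add: card_Un_disjoint)
  qed
  then show ?thesis by (simp add: parcs_graph card_Id_on card_cartesian_product)
qed

lemma card_parcs_base: "card (parcs base) = 2 * card T + card S + card E + card Z"
  using finite by (subst card_parcs_graph) (auto simp: card_Id_on intro: finite_subset[of _ "Z \<times> Z"])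

text \<open>The algorithm is told the number of arcs, so a difference here would give the planted
  graph away.\<close>

lemma card_parcs_planted: "card (parcs (planted s)) = card (parcs base)"
  unfolding card_parcs_base
  using finite by (subst card_parcs_graph) (auto simp: card_cartesian_product)

lemma successors:
  "u \<in> T \<Longrightarrow> F \<subseteq> Z \<times> UNIV \<Longrightarrow> {v. (u, v) \<in> parcs (graph F)} = {u}"
  "F \<subseteq> Z \<times> UNIV \<Longrightarrow> {v. (w, v) \<in> parcs (graph F)} = T"
  "u \<in> S \<Longrightarrow> F \<subseteq> Z \<times> UNIV \<Longrightarrow> {v. (u, v) \<in> parcs (graph F)} = {w}"
  "u \<in> Z \<Longrightarrow> {v. (u, v) \<in> parcs (planted s)} = {s}"
  using disjoint w E by (auto simp: parcs_graph)

section \<open>PageRank of a target in both instances\<close>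

context
  fixes \<alpha> :: real and t :: nat
  assumes \<alpha>: "0 < \<alpha>" "\<alpha> < 1" and t: "t \<in> T"
begin

text \<open>Solve the recurrence backwards from the target. At \<open>t\<close> it reads
  \<open>x = \<alpha> + (1 - \<alpha>) * x\<close>, at any other element of \<open>T\<close> it
  reads \<open>x = (1 - \<alpha>) * x\<close>; then come \<open>w\<close> and \<open>S\<close>.
  Walks from these nodes never meet \<open>Z\<close>, so \<open>F\<close> does not affect the
  values.\<close>

lemma ppr_graph:
  assumes F: "F \<subseteq> Z \<times> UNIV" and G: "input_graph (graph F)"
  shows "ppr \<alpha> (graph F) t t = 1"
    and "u \<in> T \<Longrightarrow> u \<noteq> t \<Longrightarrow> ppr \<alpha> (graph F) u t = 0"
    and "ppr \<alpha> (graph F) w t = (1 - \<alpha>) / card T"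
    and "s \<in> S \<Longrightarrow> ppr \<alpha> (graph F) s t = (1 - \<alpha>)\<^sup>2 / card T"
proof -
  note unfold = ppr_unfold[OF less_imp_le[OF \<alpha>(1)] less_imp_le[OF \<alpha>(2)] G]
  show 1: "ppr \<alpha> (graph F) t t = 1"
    using unfold[of t t] t \<alpha> F by (simp add: successors algebra_simps)
  show 2: "ppr \<alpha> (graph F) u t = 0" if "u \<in> T" "u \<noteq> t" for u
    using unfold[of u t] that \<alpha> F by (simp add: successors algebra_simps)
  have "(\<Sum>v\<in>T. ppr \<alpha> (graph F) v t) = (\<Sum>v\<in>T. of_bool (v = t))"
    using 1 2 by (intro sum.cong) auto
  also have "\<dots> = 1" using t finite by simp
  finally show 3: "ppr \<alpha> (graph F) w t = (1 - \<alpha>) / card T"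
    using unfold[of w t] t w F by (auto simp: successors)
  show "ppr \<alpha> (graph F) s t = (1 - \<alpha>)\<^sup>2 / card T" if "s \<in> S"
    using unfold[of s t] that 3 t disjoint F by (auto simp: successors power2_eq_square)
qed

text \<open>The hub \<open>w\<close>, the set \<open>T\<close> and the set \<open>S\<close>
  contribute at most 1 each, the last because \<open>card S \<le> card T\<close>. The rest is closed
  and contributes nothing.\<close>

lemma pagerank_base_le:
  assumes "card S \<le> card T"
  shows "pagerank \<alpha> base t \<le> 3 / card (pverts base)"
proof -
  have F: "Id_on Z \<subseteq> Z \<times> UNIV" by auto
  note ppr = ppr_graph[OF F input_graph_base]
  have zero: "ppr \<alpha> base u t = 0" if "u \<in> D \<union> Z" for u
    by (rule ppr_eq_0_if_closed[where S = "D \<union> Z"])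
      (use \<alpha> that t disjoint w E input_graph_base in \<open>auto simp: parcs_graph\<close>)
  have cT: "0 < card T" using finite T_nonempty by (simp add: card_gt_0_iff)
  have "(\<Sum>u\<in>pverts base. ppr \<alpha> base u t) =
      ppr \<alpha> base w t + (\<Sum>u\<in>T. ppr \<alpha> base u t) +
      (\<Sum>u\<in>S. ppr \<alpha> base u t) + (\<Sum>u\<in>D \<union> Z. ppr \<alpha> base u t)"
  proof -
    have "pverts base = insert w (T \<union> (S \<union> (D \<union> Z)))" by auto
    then show ?thesis using finite w disjoint
      by (simp add: Int_Un_distrib sum.union_disjoint del: pverts_graph)
  qed
  also have "(\<Sum>u\<in>D \<union> Z. ppr \<alpha> base u t) = 0" using zero by simp
  also have "(\<Sum>u\<in>T. ppr \<alpha> base u t) = (\<Sum>u\<in>T. of_bool (u = t))"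
    using ppr by (intro sum.cong) auto
  also have "\<dots> = 1" using t finite by simp
  also have "(\<Sum>u\<in>S. ppr \<alpha> base u t) = card S * ((1 - \<alpha>)\<^sup>2 / card T)" using ppr by simp
  also have "\<dots> \<le> card T * (1 / card T)"
    using assms \<alpha> by (intro mult_mono divide_right_mono) (auto simp: power_le_one)
  also have "\<dots> = 1" using cT by simp
  also have "ppr \<alpha> base w t \<le> 1"
    unfolding ppr(3) using \<alpha> cT by (simp add: divide_simps)
  finally have "(\<Sum>u\<in>pverts base. ppr \<alpha> base u t) \<le> 3" by simp
  then show ?thesis unfolding pagerank_def by (intro divide_right_mono) auto
qed

text \<open>Keep only the starts in \<open>Z\<close>: such a walk must survive the three steps to
  \<open>s\<close>, \<open>w\<close> and \<open>T\<close>, and the last step hits \<open>t\<close>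
  with probability \<open>1 / card T\<close>.\<close>

lemma pagerank_planted_ge:
  assumes s: "s \<in> S"
  shows "card Z * (1 - \<alpha>) ^ 3 / card T / card (pverts base) \<le> pagerank \<alpha> (planted s) t"
proof -
  have F: "Z \<times> {s} \<subseteq> Z \<times> UNIV" by auto
  note ppr = ppr_graph[OF F input_graph_planted[OF s]]
  have "ppr \<alpha> (planted s) z t = (1 - \<alpha>) ^ 3 / card T" if "z \<in> Z" for z
    using ppr_unfold[OF less_imp_le[OF \<alpha>(1)] less_imp_le[OF \<alpha>(2)] input_graph_planted[OF s], of z t]
      that ppr(4)[OF s] t disjoint
    by (auto simp: successors power2_eq_square power3_eq_cube)
  then have "card Z * (1 - \<alpha>) ^ 3 / card T = (\<Sum>z\<in>Z. ppr \<alpha> (planted s) z t)" by simp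
  also have "\<dots> \<le> (\<Sum>z\<in>pverts (planted s). ppr \<alpha> (planted s) z t)"
    using finite by (intro sum_mono2) (auto simp: ppr_def)
  finally have "card Z * (1 - \<alpha>) ^ 3 / card T \<le> (\<Sum>z\<in>pverts (planted s). ppr \<alpha> (planted s) z t)" .
  from divide_right_mono[OF this, of "card (pverts base)"] show ?thesis
    unfolding pagerank_def pverts_graph by simp
qed

end

section \<open>Indistinguishability of the two instances\<close>

text \<open>Away from \<open>s\<close> and \<open>Z\<close> the lists are copied from
  \<open>L\<close>, so that answers agree literally and not only up to order.\<close>

definition planted_lists :: "nat \<Rightarrow> adj_lists \<Rightarrow> adj_lists" where
  "planted_lists s L = \<lparr>
     in_list = (\<lambda>u. if u = s then sorted_list_of_set Z else if u \<in> Z then [] else in_list L u),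
     out_list = (\<lambda>u. if u \<in> Z then [s] else out_list L u),
     in_sorted_list =
       (\<lambda>u. if u = s then sorted_list_of_set Z else if u \<in> Z then [] else in_sorted_list L u)\<rparr>"

text \<open>Each node of \<open>Z\<close> exchanges its only out-arc for another one. Hence copied
  lists remain sorted by out-degree.\<close>

lemma out_degree_planted: "out_degree (with_proj (planted s)) u = out_degree (with_proj base) u"
proof (cases "u \<in> Z")
  case True
  then have "out_arcs (with_proj (planted s)) u = {(u, s)}" "out_arcs (with_proj base) u = {(u, u)}"
    using disjoint w E by (auto simp: out_arcs_def parcs_graph)
  then show ?thesis by (simp add: out_degree_def)
next
  case False
  then have "out_arcs (with_proj (planted s)) u = out_arcs (with_proj base) u"
    using disjoint w E by (auto simp: out_arcs_def parcs_graph)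
  then show ?thesis by (simp add: out_degree_def)
qed

lemma out_degree_Z: "u \<in> Z \<Longrightarrow> out_degree (with_proj base) u = 1"
proof -
  assume "u \<in> Z"
  then have "out_arcs (with_proj base) u = {(u, u)}"
    using disjoint w E by (auto simp: out_arcs_def parcs_graph)
  then show ?thesis by (simp add: out_degree_def)
qed

lemma represents_planted:
  assumes s: "s \<in> S" and L: "represents L base"
  shows "represents (planted_lists s L) (planted s)"
  unfolding represents_def
proof
  fix u assume u: "u \<in> pverts (planted s)"
  have old: "distinct (in_list L u) \<and> set (in_list L u) = {v. (v, u) \<in> parcs base} \<and>
     distinct (out_list L u) \<and> set (out_list L u) = {v. (u, v) \<in> parcs base} \<and>
     distinct (in_sorted_list L u) \<and> set (in_sorted_list L u) = {v. (v, u) \<in> parcs base} \<and>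
     sorted (map (out_degree (with_proj base)) (in_sorted_list L u))"
    using L u unfolding represents_def pverts_graph by blast
  have out: "u \<notin> Z \<Longrightarrow> {v. (u, v) \<in> parcs (planted s)} = {v. (u, v) \<in> parcs base}"
    by (auto simp: parcs_graph)
  have inn: "{v. (v, u) \<in> parcs (planted s)} =
      (if u = s then Z else if u \<in> Z then {} else {v. (v, u) \<in> parcs base})"
    using s disjoint w E by (auto simp: parcs_graph)
  \<comment> \<open>All of \<open>Z\<close> has out-degree 1, so any enumeration of \<open>Z\<close>
    is a valid answer list for \<open>IN-SORTED\<close>.\<close>
  have "map (out_degree (with_proj base)) (sorted_list_of_set Z) = map (\<lambda>_. 1) (sorted_list_of_set Z)"
    using finite out_degree_Z by simp
  then have srt: "sorted (map (out_degree (with_proj base)) (sorted_list_of_set Z))"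
    by (simp add: map_replicate_const sorted_replicate)
  have deg: "out_degree (with_proj (planted s)) = out_degree (with_proj base)"
    using out_degree_planted by auto
  show "distinct (in_list (planted_lists s L) u) \<and>
     set (in_list (planted_lists s L) u) = {v. (v, u) \<in> parcs (planted s)} \<and>
     distinct (out_list (planted_lists s L) u) \<and>
     set (out_list (planted_lists s L) u) = {v. (u, v) \<in> parcs (planted s)} \<and>
     distinct (in_sorted_list (planted_lists s L) u) \<and>
     set (in_sorted_list (planted_lists s L) u) = {v. (v, u) \<in> parcs (planted s)} \<and>
     sorted (map (out_degree (with_proj (planted s))) (in_sorted_list (planted_lists s L) u))"
    unfolding deg inn using old finite srt out successors(4)[of u s]
    by (auto simp: planted_lists_def)
qed

text \<open>Among the nodes of \<open>insert w (T \<union> S)\<close>, only \<open>s\<close> gains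
  or loses an incident arc.\<close>

lemma graph_answer_planted:
  assumes q: "query_nodes q \<subseteq> insert w (T \<union> S)" "s \<notin> query_nodes q"
  shows "graph_answer (planted s) (planted_lists s L) q = graph_answer base L q"
proof -
  have "in_degree (with_proj (planted s)) u = in_degree (with_proj base) u"
    if "u \<in> insert w (T \<union> S)" "u \<noteq> s" for u
  proof -
    have "in_arcs (with_proj (planted s)) u = in_arcs (with_proj base) u"
      using that disjoint w by (auto simp: in_arcs_def parcs_graph)
    then show ?thesis by (simp add: in_degree_def)
  qed
  moreover have "u \<notin> Z" if "u \<in> insert w (T \<union> S)" for u using that disjoint w by auto
  ultimately show ?thesis
    using q by (cases q) (auto simp: planted_lists_def out_degree_planted parcs_graph)
qed

text \<open>In \<open>base\<close> no arc in either direction joins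
  \<open>insert w (T \<union> S)\<close> to the rest, so exploration from a target stays
  inside.\<close>

lemma graph_answer_base_closed:
  assumes L: "represents L base" and q: "query_nodes q \<subseteq> insert w (T \<union> S)"
    and v: "graph_answer base L q = Node (Some v)"
  shows "v \<in> insert w (T \<union> S)"
proof -
  have nbr: "v \<in> insert w (T \<union> S)" if "u \<in> insert w (T \<union> S)" "(u, v) \<in> parcs base \<or> (v, u) \<in> parcs base" for u
    using that disjoint w E by (auto simp: parcs_graph)
  have mem: "x \<in> set xs" if "ith xs i = Some x" for xs :: "nat list" and x i
    using that by (auto simp: ith_def split: if_splits)
  have lists: "set (in_list L u) = {v. (v, u) \<in> parcs base}" "set (out_list L u) = {v. (u, v) \<in> parcs base}"
    "set (in_sorted_list L u) = {v. (v, u) \<in> parcs base}" if "u \<in> insert w (T \<union> S)" for u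
    using L that unfolding represents_def by auto
  show ?thesis
  proof (cases q)
    case (In u i)
    then show ?thesis using v q nbr[of u] mem[of "in_list L u" i v] lists(1)[of u] by auto
  next
    case (Out u i)
    then show ?thesis using v q nbr[of u] mem[of "out_list L u" i v] lists(2)[of u] by auto
  next
    case (In_Sorted u i)
    then show ?thesis using v q nbr[of u] mem[of "in_sorted_list L u" i v] lists(3)[of u] by auto
  qed (use v in auto)
qed

section \<open>The lower bound for a single target\<close>

lemma expected_time_ge:
  fixes \<alpha> \<epsilon> p\<^sub>f :: real
  assumes \<alpha>: "0 < \<alpha>" "\<alpha> < 1" and "0 < \<epsilon>" "\<epsilon> < 1" and "0 < p\<^sub>f" "p\<^sub>f < 1 / 2"
    and "card S \<le> card T"
    and gap: "3 * (1 + \<epsilon>) * card T \<le> (1 - \<epsilon>) * (1 - \<alpha>) ^ 3 * card Z"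
    and L: "represents L base" and A: "solves_single_node \<alpha> \<epsilon> p\<^sub>f A" and t: "t \<in> T"
  shows "ennreal (card S * (1 - 2 * p\<^sub>f) / 2) \<le> expected_time A base L t"
  unfolding expected_time_def
proof (rule expected_length_ge)
  fix s assume s: "s \<in> S"
  let ?C = "insert w (T \<union> S)"
  let ?N = "real (card (pverts base))"
  have cT: "0 < card T" using finite T_nonempty by (simp add: card_gt_0_iff)
  have "t \<in> pverts base" "t \<in> pverts (planted s)" using t by auto
  show "1 - 2 * p\<^sub>f \<le> measure_pmf.prob (execution A base L t) (touching s)"
  proof (rule prob_touching_ge)
    show "measure_pmf.prob (execution A base L t) (failure \<epsilon> (pagerank \<alpha> base t)) \<le> p\<^sub>f"
      using A input_graph_base L \<open>t \<in> pverts base\<close> unfolding solves_single_node_def by blast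
    show "measure_pmf.prob (execution A (planted s) (planted_lists s L) t)
        (failure \<epsilon> (pagerank \<alpha> (planted s) t)) \<le> p\<^sub>f"
      using A input_graph_planted[OF s] represents_planted[OF s L] \<open>t \<in> pverts (planted s)\<close>
      unfolding solves_single_node_def by blast
    have "(1 + \<epsilon>) * pagerank \<alpha> base t \<le> (1 + \<epsilon>) * (3 / ?N)"
      using pagerank_base_le[OF \<alpha> t \<open>card S \<le> card T\<close>] \<open>0 < \<epsilon>\<close> by (intro mult_left_mono) auto
    \<comment> \<open>Expanding by \<open>card T\<close> brings the bound into the form of
      \<open>gap\<close>.\<close>
    also have "\<dots> = 3 * (1 + \<epsilon>) * card T / card T / ?N" using cT by simp
    also have "\<dots> \<le> (1 - \<epsilon>) * (1 - \<alpha>) ^ 3 * card Z / card T / ?N"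
      using gap by (intro divide_right_mono) auto
    also have "\<dots> = (1 - \<epsilon>) * (card Z * (1 - \<alpha>) ^ 3 / card T / ?N)" by simp
    also have "\<dots> \<le> (1 - \<epsilon>) * pagerank \<alpha> (planted s) t"
      using pagerank_planted_ge[OF \<alpha> t s] \<open>\<epsilon> < 1\<close> by (intro mult_left_mono) auto
    finally show "(1 + \<epsilon>) * pagerank \<alpha> base t \<le> (1 - \<epsilon>) * pagerank \<alpha> (planted s) t" .
  next
    fix y h assume h: "s \<notin> touched h"
    have "spmf (run (A (card (pverts base)) (card (parcs base)) t) (respond base L t) []) (y, h)
      \<le> spmf (run (A (card (pverts base)) (card (parcs base)) t)
          (respond (planted s) (planted_lists s L) t) []) (y, h)"
    proof (rule run_until_touched[where I = "\<lambda>h. known_nodes t h \<subseteq> ?C"])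
      fix h q assume "known_nodes t h \<subseteq> ?C" "s \<notin> query_nodes q"
      then show "respond base L t h q = respond (planted s) (planted_lists s L) t h q"
        using graph_answer_planted[of q s L] by (auto simp: respond_def)
    next
      fix h q assume h: "known_nodes t h \<subseteq> ?C"
      \<comment> \<open>The invariant: only nodes of \<open>?C\<close> ever become known, hence
        every query that is not refused is covered by \<open>graph_answer_planted\<close> unless it
        involves \<open>s\<close>.\<close>
      have "v \<in> ?C" if "Node (Some v) = respond base L t h q" for v
        using that h graph_answer_base_closed[OF L, of q v] by (auto simp: respond_def split: if_splits)
      then show "known_nodes t (h @ [(q, respond base L t h q)]) \<subseteq> ?C"
        using h unfolding known_nodes_def by auto
    next
      show "known_nodes t [] \<subseteq> ?C" using t by (simp add: known_nodes_def)
    qed (rule h)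
    then show "spmf (execution A base L t) (y, h) \<le> spmf (execution A (planted s) (planted_lists s L) t) (y, h)"
      unfolding execution_def by (simp add: card_parcs_planted)
  qed
qed (use finite assms in auto)

end

section \<open>Choice of the parameters and averaging over the targets\<close>

theorem theorem6p6:
  fixes \<alpha> \<epsilon> p\<^sub>f :: real
  assumes "0 < \<alpha>" "\<alpha> < 1"
    and "0 < \<epsilon>" "\<epsilon> < 1"
    and "0 < p\<^sub>f" "p\<^sub>f < 1 / 2"
  shows "\<exists>a\<^sub>1 a\<^sub>2 b\<^sub>1 b\<^sub>2 c :: real. a\<^sub>1 > 0 \<and> a\<^sub>2 > 0 \<and> b\<^sub>1 > 0 \<and> b\<^sub>2 > 0 \<and> c > 0 \<and>
    (\<forall>n m :: nat. 1 \<le> n \<longrightarrow> n \<le> m \<longrightarrow> m \<le> n\<^sup>2 \<longrightarrow>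
      (\<exists>G :: nat pair_pre_digraph. input_graph G \<and>
        a\<^sub>1 * real n \<le> real (card (pverts G)) \<and> real (card (pverts G)) \<le> a\<^sub>2 * real n \<and>
        b\<^sub>1 * real m \<le> real (card (parcs G)) \<and> real (card (parcs G)) \<le> b\<^sub>2 * real m \<and>
        (\<forall>L A. represents L G \<longrightarrow> solves_single_node \<alpha> \<epsilon> p\<^sub>f A \<longrightarrow>
          average_expected_time A G L \<ge> ennreal (c * real n) \<and>
          (\<exists>t\<in>pverts G. expected_time A G L t \<ge> ennreal (c * real n)))))"
proof -
  have pos: "0 < (1 - \<epsilon>) * (1 - \<alpha>) ^ 3" using assms by simp
  \<comment> \<open>\<open>K\<close> depends on \<alpha> and \<epsilon> only, so \<open>Z\<close>
    has linear size; with \<open>card T = n\<close> and \<open>card Z = K * n\<close> this bound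
    becomes \<open>gap\<close>.\<close>
  obtain K :: nat where "3 * (1 + \<epsilon>) / ((1 - \<epsilon>) * (1 - \<alpha>) ^ 3) \<le> real K"
    using real_arch_simple by blast
  then have K: "3 * (1 + \<epsilon>) \<le> (1 - \<epsilon>) * (1 - \<alpha>) ^ 3 * real K"
    using pos by (simp add: pos_divide_le_eq mult.commute)
  \<comment> \<open>One factor 1/2 is for the two nodes of an \<open>Adj\<close> query. The divisor
    \<open>K + 4\<close> is for averaging: \<open>T\<close> has \<open>n\<close> of the at most
    \<open>(K + 4) * n\<close> nodes.\<close>
  define c where "c = (1 - 2 * p\<^sub>f) / 2 / (real K + 4)"
  have "0 < c" using assms by (simp add: c_def)
  have c_le: "c \<le> (1 - 2 * p\<^sub>f) / 2" using assms divide_left_mono[of 1 "real K + 4" "(1 - 2 * p\<^sub>f) / 2"] by (simp add: c_def)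
  have "\<exists>G :: nat pair_pre_digraph. input_graph G \<and>
        1 * real n \<le> real (card (pverts G)) \<and> real (card (pverts G)) \<le> (real K + 4) * real n \<and>
        1 * real m \<le> real (card (parcs G)) \<and> real (card (parcs G)) \<le> (real K + 4) * real m \<and>
        (\<forall>L A. represents L G \<longrightarrow> solves_single_node \<alpha> \<epsilon> p\<^sub>f A \<longrightarrow>
          average_expected_time A G L \<ge> ennreal (c * real n) \<and>
          (\<exists>t\<in>pverts G. expected_time A G L t \<ge> ennreal (c * real n)))"
    if n: "1 \<le> n" and "n \<le> m" "m \<le> n\<^sup>2" for n m :: nat
  proof -
    define T S w D Z where sets: "T = {..<n}" "S = {n..<2 * n}" "w = 2 * n" "D = {2 * n + 1..<3 * n + 1}"
      "Z = {3 * n + 1..<3 * n + 1 + K * n}"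
    have cards: "card T = n" "card S = n" "card D = n" "card Z = K * n" by (simp_all add: sets)
    \<comment> \<open>The hypotheses \<open>n \<le> m\<close> and \<open>m \<le> n\<^sup>2\<close>
      are exactly the room between the loops on \<open>D\<close> and all of
      \<open>D \<times> D\<close>.\<close>
    have "card (Id_on D) \<le> m" "m \<le> card (D \<times> D)" "Id_on D \<subseteq> D \<times> D" "finite (D \<times> D)"
      using \<open>n \<le> m\<close> \<open>m \<le> n\<^sup>2\<close> by (auto simp: card_Id_on card_cartesian_product power2_eq_square cards sets)
    from exists_subset_between[OF this] obtain E where dense: "Id_on D \<subseteq> E" "E \<subseteq> D \<times> D" "card E = m"
      by blast
    interpret hidden_source T S D Z w E
      using dense n by unfold_locales (auto simp: sets lessThan_empty_iff)
    have "pverts base = {..<3 * n + 1 + K * n}" unfolding pverts_graph by (auto simp: sets)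
    then have card_verts: "card (pverts base) = 3 * n + 1 + K * n" by simp
    \<comment> \<open>The single hub is absorbed by \<open>1 \<le> n\<close>.\<close>
    have "card (pverts base) \<le> (K + 4) * n" unfolding card_verts using n by (simp add: algebra_simps)
    then have verts_le: "real (card (pverts base)) \<le> (real K + 4) * real n"
      by (metis of_nat_add of_nat_le_iff of_nat_mult of_nat_numeral)
    have card_arcs: "card (parcs base) = 3 * n + m + K * n"
      using dense by (simp add: card_parcs_base cards)
    have "K * n \<le> K * m" using \<open>n \<le> m\<close> by simp
    then have "card (parcs base) \<le> (K + 4) * m"
      unfolding card_arcs add_mult_distrib using \<open>n \<le> m\<close> by linarith
    then have arcs_le: "real (card (parcs base)) \<le> (real K + 4) * real m"
      by (metis of_nat_add of_nat_le_iff of_nat_mult of_nat_numeral)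
    have time: "ennreal (n * (1 - 2 * p\<^sub>f) / 2) \<le> expected_time A base L t"
      if "represents L base" "solves_single_node \<alpha> \<epsilon> p\<^sub>f A" "t \<in> T" for L A t
    proof -
      have "3 * (1 + \<epsilon>) * real n \<le> (1 - \<epsilon>) * (1 - \<alpha>) ^ 3 * real K * real n"
        using K by (intro mult_right_mono) auto
      then show ?thesis using expected_time_ge[OF assms _ _ that] by (simp add: mult.assoc cards)
    qed
    have "average_expected_time A base L \<ge> ennreal (c * real n)"
      if L: "represents L base" "solves_single_node \<alpha> \<epsilon> p\<^sub>f A" for L A
    proof -
      let ?N = "card (pverts base)"
      have "0 < ?N" using card_verts by simp
      have "c * real n * real ?N \<le> c * real n * ((real K + 4) * real n)"
        using verts_le \<open>0 < c\<close> by (intro mult_left_mono) auto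
      also have "\<dots> = real n * (real n * (1 - 2 * p\<^sub>f) / 2)" by (simp add: c_def field_simps)
      finally have "c * real n \<le> real n * (real n * (1 - 2 * p\<^sub>f) / 2) / real ?N"
        using \<open>0 < ?N\<close> by (simp add: pos_le_divide_eq)
      then have "ennreal (c * real n) \<le> ennreal (real n * (real n * (1 - 2 * p\<^sub>f) / 2) / real ?N)"
        by (rule ennreal_leI)
      also have "\<dots> = ennreal (real n * (real n * (1 - 2 * p\<^sub>f) / 2)) / of_nat ?N"
        using \<open>0 < ?N\<close> assms by (simp add: divide_ennreal ennreal_of_nat_eq_real_of_nat)
      also have "ennreal (real n * (real n * (1 - 2 * p\<^sub>f) / 2)) = (\<Sum>t\<in>T. ennreal (real n * (1 - 2 * p\<^sub>f) / 2))"
        using assms by (subst ennreal_mult) (auto simp: cards ennreal_of_nat_eq_real_of_nat)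
      also have "\<dots> \<le> (\<Sum>t\<in>T. expected_time A base L t)"
        using time[OF L] by (intro sum_mono) auto
      \<comment> \<open>Nodes outside \<open>T\<close> are counted with time at least 0.\<close>
      also have "\<dots> \<le> (\<Sum>t\<in>pverts base. expected_time A base L t)"
        using finite by (intro sum_mono2) auto
      finally show ?thesis unfolding average_expected_time_def
        by (simp add: divide_right_mono_ennreal)
    qed
    moreover have "\<exists>t\<in>pverts base. expected_time A base L t \<ge> ennreal (c * real n)"
      if L: "represents L base" "solves_single_node \<alpha> \<epsilon> p\<^sub>f A" for L A
    proof
      \<comment> \<open>Any element of \<open>T\<close> serves as the worst-case target;
        \<open>0\<close> is one since \<open>T = {..<n}\<close> and
        \<open>1 \<le> n\<close>.\<close>
      show "0 \<in> pverts base" unfolding pverts_graph using n by (auto simp: sets)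
      have "c * real n \<le> n * (1 - 2 * p\<^sub>f) / 2" using mult_right_mono[OF c_le, of "real n"] by (simp add: mult.commute)
      then have "ennreal (c * real n) \<le> ennreal (n * (1 - 2 * p\<^sub>f) / 2)" by (rule ennreal_leI)
      also have "\<dots> \<le> expected_time A base L 0" using time[OF L, of 0] n unfolding sets(1) by simp
      finally show "ennreal (c * real n) \<le> expected_time A base L 0" .
    qed
    ultimately show ?thesis
      using input_graph_base verts_le arcs_le card_verts card_arcs
      by (intro exI[of _ base]) auto
  qed
  moreover have "0 < real K + 4" by simp
  ultimately show ?thesis using \<open>0 < c\<close>
    by (intro exI[of _ 1] exI[of _ "real K + 4"] exI[of _ c] conjI allI impI) auto
qed

end
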